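(* Let $\Phi\in\Psi$, $\Phi(x)=\int_0^x\varphi(t)\,dt$, where $\varphi\in\Im$ is discontinuous at every term of a decreasing sequence $(a_k)_{k\ge1}$ of positive real numbers converging to $0$. Let $S_n\subset C([a,b])$ be a 1-space such that every nonzero $P\in S_n$ has only finitely many zeros on $[a,b]$. Then for every $f\in C([a,b])$ the best approximation set $\mu_\Phi(f/S_n)$ is a singleton.
   Context: All functions are real-valued and measure is Lebesgue measure on the compact interval $[a,b]$; $|A|$ denotes the Lebesgue measure of a set $A$. $\Im$ is the class of all non-decreasing functions $\varphi$ defined for all real $t\ge 0$ with $\varphi(t)>0$ for $t>0$. $\Psi$ is the class of all convex functions $\Phi(x)=\int_0^x\varphi(t)\,dt$, $x\ge 0$, with $\varphi\in\Im$; it is assumed throughout that $\Phi$ satisfies the $\Delta_2$ condition: there is a constant $\Lambda>0$ with $\Phi(2x)\le\Lambda\Phi(x)$ for all $x\ge0$. $\mu_\Phi(f/S_n)$ is the set of all $P\in S_n$ with $\int_a^b\Phi(|f-P|)\,dx=\inf_{Q\in S_n}\int_a^b\Phi(|f-Q|)\,dx$. An $n$-dimensional linear space $S_n\subset C([a,b])$ is a 1-space if there exists $h\in S_n$ with $h(x)>0$ for every $x\in[a,b]$, and whenever $P_1,P_2\in S_n$ with $P_1\ne P_2$ one has $|\{x\in[a,b]:P_1(x)=P_2(x)\}|=0$. *)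

theory Defs
  imports "HOL-Analysis.Analysis" "HOL-Library.Function_Algebras"
begin

(* Real functions form a vector space under the pointwise operations (addition and zero are those
   of Function_Algebras); this makes real_fun.subspace, real_fun.span, ... available. *)
global_interpretation real_fun: vector_space "\<lambda>(c::real) (f::real \<Rightarrow> real) x. c * f x"
  by unfold_locales (auto simp: fun_eq_iff algebra_simps)

(* An element of C([a,b]) is represented by its extension by 0 to the whole line, so that
   pointwise operations stay inside the set and equality of functions is equality on [a,b]. *)
definition C_space :: "real \<Rightarrow> real \<Rightarrow> (real \<Rightarrow> real) set" where
  "C_space a b = {f. continuous_on {a..b} f \<and> (\<forall>x. x \<notin> {a..b} \<longrightarrow> f x = 0)}"

definition n_dim_space :: "nat \<Rightarrow> (real \<Rightarrow> real) set \<Rightarrow> bool" where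
  "n_dim_space n S \<longleftrightarrow> real_fun.subspace S \<and>
     (\<exists>B. finite B \<and> card B = n \<and> real_fun.independent B \<and> real_fun.span B = S)"

definition one_space :: "real \<Rightarrow> real \<Rightarrow> nat \<Rightarrow> (real \<Rightarrow> real) set \<Rightarrow> bool" where
  "one_space a b n S \<longleftrightarrow> n_dim_space n S \<and> S \<subseteq> C_space a b \<and>
     (\<exists>h\<in>S. \<forall>x\<in>{a..b}. h x > 0) \<and>
     (\<forall>P1\<in>S. \<forall>P2\<in>S. P1 \<noteq> P2 \<longrightarrow> measure lebesgue {x\<in>{a..b}. P1 x = P2 x} = 0)"

(* The functions in the next two classes have domain [0,\<infinity>); their values at negative
   arguments are never used. *)
definition Im_class :: "(real \<Rightarrow> real) set" where
  "Im_class = {\<phi>. mono_on {0..} \<phi> \<and> (\<forall>t>0. \<phi> t > 0)}"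

definition has_density :: "(real \<Rightarrow> real) \<Rightarrow> (real \<Rightarrow> real) \<Rightarrow> bool" where
  "has_density \<Phi> \<phi> \<longleftrightarrow> (\<forall>x\<ge>0. \<Phi> x = integral {0..x} \<phi>)"

definition Psi_class :: "(real \<Rightarrow> real) set" where
  "Psi_class = {\<Phi>. convex_on {0..} \<Phi> \<and> (\<exists>\<phi>\<in>Im_class. has_density \<Phi> \<phi>)}"

definition Delta2 :: "(real \<Rightarrow> real) \<Rightarrow> bool" where
  "Delta2 \<Phi> \<longleftrightarrow> (\<exists>\<Lambda>>0. \<forall>x\<ge>0. \<Phi> (2 * x) \<le> \<Lambda> * \<Phi> x)"

definition mu :: "(real \<Rightarrow> real) \<Rightarrow> real \<Rightarrow> real \<Rightarrow> (real \<Rightarrow> real) \<Rightarrow> (real \<Rightarrow> real) set \<Rightarrow> (real \<Rightarrow> real) set" where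
  "mu \<Phi> a b f S = {P\<in>S. integral {a..b} (\<lambda>x. \<Phi> \<bar>f x - P x\<bar>) =
                        (INF Q\<in>S. integral {a..b} (\<lambda>x. \<Phi> \<bar>f x - Q x\<bar>))}"

end

theory Submission
  imports Defs
begin

text \<open>
  Existence is a compactness argument.  \<open>\<Phi>\<close> grows at least linearly
  (\<open>convex_strict_mono_linear_growth\<close>), and on a finite dimensional space the \<open>L\<^sup>1\<close> norm dominates
  the coefficients (\<open>L1_norm_bounds_coefficients\<close>); hence only a compact set of coefficients
  competes, and the error integral is continuous there.

  For uniqueness, let \<open>P1 \<noteq> P2\<close> be best approximants, \<open>u = \<bar>f - P1\<bar>\<close> and \<open>v = \<bar>f - P2\<bar>\<close>.  By
  convexity the midpoint \<open>P\<close> is best too, and Jensen's inequality for it must be an equality at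
  every point (\<open>midpoint_equality_pointwise\<close>).  This says two things: \<open>\<bar>f - P\<bar> = (u + v) / 2\<close>, so
  the errors never have opposite signs; and \<open>\<Phi>\<close> is affine between \<open>u x\<close> and \<open>v x\<close>, so that \<open>\<phi>\<close>
  is constant there and no jump of \<open>\<phi>\<close> lies strictly between them (\<open>no_jump_in_affine_gap\<close>).

  The error \<open>f - P\<close> has a zero, because otherwise it would keep its sign and adding a small
  multiple of the positive function \<open>h\<close> to \<open>P\<close>, or subtracting it, would improve \<open>P\<close>
  (\<open>best_approximant_error_has_zero\<close>).  There \<open>u = v = 0\<close>, while \<open>max u v\<close> is positive somewhere.
  By connectedness of \<open>[a, b]\<close>, \<open>max u v\<close> has to climb past every small jump point \<open>c k\<close>; as \<open>c k\<close>
  may not separate \<open>u\<close> from \<open>v\<close>, this can only happen at a point where \<open>u = v = c k\<close>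
  (\<open>gap_crosses_level\<close>), hence at a zero of \<open>P1 - P2\<close>.  But there are infinitely many small jump
  points, since they tend to \<open>0\<close>, and only finitely many zeros.
\<close>

section \<open>Convex functions with a monotone density\<close>

lemma density_increment_bounds:
  assumes "mono_on {0..} \<phi>" and "has_density \<Phi> \<phi>" and "0 \<le> x" and "x \<le> y"
  shows "\<phi> x * (y - x) \<le> \<Phi> y - \<Phi> x" and "\<Phi> y - \<Phi> x \<le> \<phi> y * (y - x)"
proof -
  have int: "\<phi> integrable_on {u..v}" if "0 \<le> u" for u v
    by (rule integrable_on_mono_on, rule mono_on_subset[OF assms(1)]) (use that in auto)
  have "integral {0..x} \<phi> + integral {x..y} \<phi> = integral {0..y} \<phi>"
    using Henstock_Kurzweil_Integration.integral_combine[OF assms(3,4) int] by simp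
  then have eq: "\<Phi> y - \<Phi> x = integral {x..y} \<phi>"
    using assms unfolding has_density_def by (metis add_diff_cancel_left' order_trans)
  have mono: "\<phi> x \<le> \<phi> t" "\<phi> t \<le> \<phi> y" if "t \<in> {x..y}" for t
    using that assms by (auto intro!: mono_onD[OF assms(1)])
  have "integral {x..y} (\<lambda>_. \<phi> x) \<le> integral {x..y} \<phi>"
    by (rule integral_le) (use mono int assms in auto)
  then show "\<phi> x * (y - x) \<le> \<Phi> y - \<Phi> x"
    using assms eq by (simp add: mult.commute)
  have "integral {x..y} \<phi> \<le> integral {x..y} (\<lambda>_. \<phi> y)"
    by (rule integral_le) (use mono int assms in auto)
  then show "\<Phi> y - \<Phi> x \<le> \<phi> y * (y - x)"
    using assms eq by (simp add: mult.commute)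
qed

lemma density_continuous:
  assumes "mono_on {0..} \<phi>" and "has_density \<Phi> \<phi>"
  shows "continuous_on {0..} \<Phi>"
proof -
  have "continuous_on {0..r} \<Phi>" for r
  proof -
    have "\<phi> integrable_on {0..r}"
      by (rule integrable_on_mono_on, rule mono_on_subset[OF assms(1)]) auto
    then have "continuous_on {0..r} (\<lambda>x. integral {0..x} \<phi>)"
      by (rule indefinite_integral_continuous_1)
    then show ?thesis
      by (rule continuous_on_eq) (use assms(2) in \<open>auto simp: has_density_def\<close>)
  qed
  then have "continuous_on {0..<x + 1} \<Phi>" for x
    by (rule continuous_on_subset[of "{0..x + 1}"]) auto
  then have "continuous (at x within {0..<x + 1}) \<Phi>" if "0 \<le> x" for x
    using that by (auto simp: continuous_on_eq_continuous_within)
  moreover have "at x within {0..<x + 1} = at x within {0..}" for x :: real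
    by (rule at_within_nhd[of _ "{..<x + 1}"]) auto
  ultimately show ?thesis
    by (auto simp: continuous_on_eq_continuous_within)
qed

text \<open>
  Away from \<open>0\<close> the density is positive, which gives strict growth there; the value of the density at
  \<open>0\<close> may be negative, so growth from \<open>0\<close> is obtained as a limit.
\<close>

lemma density_strict_mono:
  assumes "\<phi> \<in> Im_class" and "has_density \<Phi> \<phi>"
  shows "strict_mono_on {0..} \<Phi>"
proof -
  have mono: "mono_on {0..} \<phi>" and pos: "\<And>t. t > 0 \<Longrightarrow> \<phi> t > 0"
    using assms(1) by (auto simp: Im_class_def)
  have less: "\<Phi> x < \<Phi> y" if "0 < x" "x < y" for x y
  proof -
    have "0 < \<phi> x * (y - x)" using that pos by simp
    then show ?thesis using density_increment_bounds(1)[OF mono assms(2), of x y] that by simp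
  qed
  have "\<Phi> 0 < \<Phi> y" if y: "0 < y" for y
  proof -
    have "(\<Phi> \<longlongrightarrow> \<Phi> 0) (at 0 within {0..})"
      using density_continuous[OF mono assms(2)] by (simp add: continuous_on_def)
    then have "(\<Phi> \<longlongrightarrow> \<Phi> 0) (at_right 0)"
      by (rule tendsto_within_subset) auto
    moreover have "\<forall>\<^sub>F x in at_right 0. \<Phi> x \<le> \<Phi> (y / 2)"
      using y less by (auto simp: eventually_at_right intro!: exI[of _ "y / 2"] less_imp_le)
    ultimately have "\<Phi> 0 \<le> \<Phi> (y / 2)"
      by (rule tendsto_upperbound) simp
    then show ?thesis using less[of "y / 2" y] y by simp
  qed
  then show ?thesis
    using less by (auto simp: strict_mono_on_def less_le)
qed

text \<open>
  The increment of \<open>\<Phi>\<close> over the left half of \<open>[p, q]\<close> is at most what the value of the density at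
  the midpoint gives, the increment over the right half is at least that.  If the two increments
  agree, neither estimate has slack, so the monotone density cannot move inside the interval.
\<close>

lemma density_constant_if_midpoint_affine:
  assumes "mono_on {0..} \<phi>" and "has_density \<Phi> \<phi>" and "0 \<le> p"
    and eq: "\<Phi> ((p + q) / 2) = (\<Phi> p + \<Phi> q) / 2" and x: "x \<in> {p<..<q}"
  shows "\<phi> x = \<phi> ((p + q) / 2)"
proof -
  define m where "m = (p + q) / 2"
  note bd = density_increment_bounds[OF assms(1,2)]
  have m: "p < m" "m < q" "q - m = m - p" using x by (auto simp: m_def field_simps)
  have eq': "\<Phi> m - \<Phi> p = \<Phi> q - \<Phi> m" using eq by (simp add: m_def)
  have "\<phi> x = \<phi> m"
  proof (cases "x \<le> m")
    case True
    have "\<phi> m * (m - p) \<le> \<Phi> q - \<Phi> m" using bd(1)[of m q] m assms(3) by simp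
    also have "\<dots> = (\<Phi> m - \<Phi> x) + (\<Phi> x - \<Phi> p)" using eq' by simp
    also have "\<dots> \<le> \<phi> m * (m - x) + \<phi> x * (x - p)"
      using bd(2)[of x m] bd(2)[of p x] True x assms(3) by simp
    finally have "\<phi> m * (x - p) \<le> \<phi> x * (x - p)" by (simp add: algebra_simps)
    moreover have "\<phi> x \<le> \<phi> m" using True x assms(3) by (intro mono_onD[OF assms(1)]) auto
    ultimately show ?thesis using x by simp
  next
    case False
    have "\<phi> m * (x - m) + \<phi> x * (q - x) \<le> (\<Phi> x - \<Phi> m) + (\<Phi> q - \<Phi> x)"
      using bd(1)[of m x] bd(1)[of x q] False x m assms(3) by simp
    also have "\<dots> = \<Phi> m - \<Phi> p" using eq' by simp
    also have "\<dots> \<le> \<phi> m * (q - m)" using bd(2)[of p m] m assms(3) by simp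
    finally have "\<phi> x * (q - x) \<le> \<phi> m * (q - x)" by (simp add: algebra_simps)
    moreover have "\<phi> m \<le> \<phi> x" using False x m assms(3) by (intro mono_onD[OF assms(1)]) auto
    ultimately show ?thesis using x by simp
  qed
  then show ?thesis by (simp add: m_def)
qed

lemma no_jump_in_affine_gap:
  assumes "mono_on {0..} \<phi>" and "has_density \<Phi> \<phi>" and "0 \<le> p"
    and eq: "\<Phi> ((p + q) / 2) = (\<Phi> p + \<Phi> q) / 2"
    and jump: "\<not> continuous (at c within {0..}) \<phi>"
  shows "c \<notin> {p<..<q}"
proof
  assume c: "c \<in> {p<..<q}"
  have "continuous_on {p<..<q} \<phi>"
    by (rule continuous_on_eq[OF continuous_on_const])
       (rule density_constant_if_midpoint_affine[OF assms(1-4), symmetric])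
  then have "isCont \<phi> c"
    using c by (simp add: continuous_on_eq_continuous_at)
  then show False
    using jump continuous_at_imp_continuous_at_within by blast
qed

section \<open>Existence of best approximants\<close>

lemma span_range_combination:
  assumes "finite B"
  shows "real_fun.span B = range (\<lambda>t x. \<Sum>e\<in>B. t e * e x)"
proof -
  have "(\<Sum>e\<in>B. (\<lambda>x. t e * e x)) = (\<lambda>x. \<Sum>e\<in>B. t e * e x)" for t
    using assms by (induction B rule: finite_induct) (auto simp: fun_eq_iff)
  then show ?thesis
    by (simp add: real_fun.span_finite[OF assms])
qed

lemma independent_combination:
  assumes "finite B" and "real_fun.independent B" and "(\<lambda>x. \<Sum>e\<in>B. t e * e x) = 0" and "e \<in> B"
  shows "t e = 0"
proof -
  have "(\<Sum>e\<in>B. (\<lambda>x. t e * e x)) = (\<lambda>x. \<Sum>e\<in>B. t e * e x)"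
    using assms(1) by (induction B rule: finite_induct) (auto simp: fun_eq_iff)
  then show ?thesis
    using real_fun.independentD[OF assms(2,1) order_refl _ assms(4), of t] assms(3) by simp
qed

text \<open>
  The dimension is a number and not a type, so coefficient vectors are functions on all of the type
  that vanish off the basis, with the product topology; compactness is Tychonoff's theorem.
\<close>

lemma compact_coefficient_box:
  fixes R :: real
  shows "compact {t :: 'a \<Rightarrow> real. \<forall>e. t e \<in> (if e \<in> B then {-R..R} else {0})}"
proof -
  have "compactin (product_topology (\<lambda>_. euclidean) UNIV)
          (PiE UNIV (\<lambda>e. if e \<in> B then {-R..R} else {0 :: real}))"
    by (subst compactin_PiE) auto
  then show ?thesis
    by (simp add: euclidean_product_topology PiE_UNIV_domain Pi_def)
qed

lemma continuous_on_combination_integral: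
  fixes \<Theta> f :: "real \<Rightarrow> real"
  assumes "continuous_on {0..} \<Theta>" and "continuous_on {a..b} f"
    and "\<And>e. e \<in> B \<Longrightarrow> continuous_on {a..b} e"
  shows "continuous_on T (\<lambda>t. integral {a..b} (\<lambda>x. \<Theta> \<bar>f x - (\<Sum>e\<in>B. t e * e x)\<bar>))"
proof -
  let ?X = "T \<times> cbox a b"
  have coord: "continuous_on ?X (\<lambda>z. fst z e)" for e
    by (rule continuous_on_product_then_coordinatewise[of ?X fst])
       (intro continuous_on_fst continuous_on_id)
  have "continuous_on ?X (\<lambda>z. e (snd z))" if "e \<in> insert f B" for e
    using that assms(2,3)
    by (intro continuous_on_compose2[of "{a..b}" e ?X snd] continuous_on_snd continuous_on_id) auto
  then have "continuous_on ?X (\<lambda>z. \<bar>f (snd z) - (\<Sum>e\<in>B. fst z e * e (snd z))\<bar>)"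
    by (intro continuous_on_rabs continuous_on_diff continuous_on_sum continuous_on_mult coord) auto
  then have "continuous_on ?X (\<lambda>z. \<Theta> \<bar>f (snd z) - (\<Sum>e\<in>B. fst z e * e (snd z))\<bar>)"
    by (rule continuous_on_compose2[OF assms(1)]) auto
  then have "continuous_on T (\<lambda>t. integral (cbox a b) (\<lambda>x. \<Theta> \<bar>f x - (\<Sum>e\<in>B. t e * e x)\<bar>))"
    by (intro integral_continuous_on_param) (simp add: case_prod_beta')
  then show ?thesis by simp
qed

text \<open>
  All norms on a finite dimensional space are equivalent; the instance needed compares the
  \<open>L\<^sup>1\<close> norm with the sum of the absolute coefficients, by minimising the former
  over the compact unit sphere of the latter.
\<close>

lemma L1_norm_bounds_coefficients:
  fixes B :: "(real \<Rightarrow> real) set"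
  assumes "a < b" and "finite B" and "real_fun.independent B" and "B \<subseteq> C_space a b"
  obtains \<delta> where "\<delta> > 0"
    and "\<And>t. \<delta> * (\<Sum>e\<in>B. \<bar>t e\<bar>) \<le> integral {a..b} (\<lambda>x. \<bar>\<Sum>e\<in>B. t e * e x\<bar>)"
proof -
  define G where "G = (\<lambda>t. integral {a..b} (\<lambda>x. \<bar>\<Sum>e\<in>B. t e * e x\<bar>))"
  define D where "D = {t. \<forall>e. t e \<in> (if e \<in> B then {-1..1} else {0 :: real})}
    \<inter> {t. (\<Sum>e\<in>B. \<bar>t e\<bar>) = 1}"
  have cont: "continuous_on {a..b} e" if "e \<in> B" for e
    using that assms(4) by (auto simp: C_space_def)
  have zero: "e x = 0" if "e \<in> B" "x \<notin> {a..b}" for e x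
    using that assms(4) by (auto simp: C_space_def)
  have contG: "continuous_on D G"
    unfolding G_def
    using continuous_on_combination_integral[of "\<lambda>x. x" a b "\<lambda>_. 0" B D] cont by simp
  have "closed {t :: (real \<Rightarrow> real) \<Rightarrow> real. (\<Sum>e\<in>B. \<bar>t e\<bar>) = 1}"
    by (intro closed_Collect_eq continuous_intros) auto
  then have cD: "compact D"
    unfolding D_def by (intro compact_Int_closed compact_coefficient_box)
  have G_pos: "G t > 0" if "t \<in> D" for t
  proof -
    have c: "continuous_on {a..b} (\<lambda>x. \<bar>\<Sum>e\<in>B. t e * e x\<bar>)"
      by (intro continuous_intros cont)
    have "G t \<ge> 0" unfolding G_def
      by (rule integral_nonneg) (use integrable_continuous_real[OF c] in auto)
    moreover have "G t \<noteq> 0"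
    proof
      assume "G t = 0"
      then have "\<forall>x\<in>{a..b}. \<bar>\<Sum>e\<in>B. t e * e x\<bar> = 0"
        unfolding G_def by (subst (asm) integral_eq_0_iff[OF c assms(1)]) auto
      then have "(\<lambda>x. \<Sum>e\<in>B. t e * e x) = 0"
        using zero by (fastforce simp: fun_eq_iff intro: sum.neutral)
      then have "t e = 0" if "e \<in> B" for e
        using independent_combination[OF assms(2,3)] that by blast
      then show False using that by (simp add: D_def)
    qed
    ultimately show ?thesis by simp
  qed
  obtain \<delta> where \<delta>: "\<delta> > 0" "\<And>t. t \<in> D \<Longrightarrow> \<delta> \<le> G t"
  proof (cases "D = {}")
    case True
    then show ?thesis using that[of 1] by simp
  next
    case False
    then obtain t0 where "t0 \<in> D" "\<forall>t\<in>D. G t0 \<le> G t"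
      using continuous_attains_inf[OF cD _ contG] by blast
    then show ?thesis using that[of "G t0"] G_pos by blast
  qed
  have "\<delta> * (\<Sum>e\<in>B. \<bar>t e\<bar>) \<le> G t" for t
  proof (cases "(\<Sum>e\<in>B. \<bar>t e\<bar>) = 0")
    case True
    have "G t \<ge> 0" unfolding G_def
      by (rule integral_nonneg) (use cont in \<open>auto intro!: integrable_continuous_real continuous_intros\<close>)
    then show ?thesis using True by simp
  next
    case False
    define s where "s = (\<Sum>e\<in>B. \<bar>t e\<bar>)"
    have s: "s > 0" using False by (simp add: s_def sum_nonneg less_le)
    define t' where "t' = (\<lambda>e. if e \<in> B then t e / s else 0)"
    have "\<bar>t e\<bar> \<le> s" if "e \<in> B" for e
      unfolding s_def using assms(2) that by (intro member_le_sum) auto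
    then have "\<bar>t e / s\<bar> \<le> 1" if "e \<in> B" for e
      using that s by (simp add: field_simps)
    then have "t' e \<in> {-1..1}" if "e \<in> B" for e
      using that unfolding abs_le_iff by (force simp: t'_def)
    moreover have "(\<Sum>e\<in>B. \<bar>t' e\<bar>) = s / s"
    proof -
      have "(\<Sum>e\<in>B. \<bar>t' e\<bar>) = (\<Sum>e\<in>B. \<bar>t e\<bar> / s)"
        using s by (intro sum.cong) (auto simp: t'_def)
      then show ?thesis by (simp only: s_def sum_divide_distrib[symmetric])
    qed
    ultimately have "t' \<in> D"
      using s by (auto simp: D_def t'_def)
    then have "\<delta> \<le> G t'" by (rule \<delta>(2))
    also have "G t' = G t / s"
    proof -
      have "\<bar>\<Sum>e\<in>B. t' e * e x\<bar> = \<bar>\<Sum>e\<in>B. t e * e x\<bar> / s" for x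
        using s by (simp add: t'_def flip: sum_divide_distrib)
      then show ?thesis by (simp add: G_def)
    qed
    finally show ?thesis using s by (simp add: s_def[symmetric] field_simps)
  qed
  then show ?thesis using that \<delta>(1) by (simp add: G_def)
qed

text \<open>
  Linear growth of \<open>\<Theta>\<close> confines the competitors that beat the zero function to a
  bounded set of coefficients, and a continuous function on a compact box has a minimum.
\<close>

lemma best_approximant_exists:
  assumes "a < b" and "n_dim_space n S" and "S \<subseteq> C_space a b" and "f \<in> C_space a b"
    and cont: "continuous_on {0..} \<Theta>"
    and growth: "\<alpha> > 0" "\<And>x. x \<ge> 0 \<Longrightarrow> \<alpha> * x - \<beta> \<le> \<Theta> x"
  obtains P where "P \<in> S"
    and "\<And>Q. Q \<in> S \<Longrightarrow> integral {a..b} (\<lambda>x. \<Theta> \<bar>f x - P x\<bar>) \<le> integral {a..b} (\<lambda>x. \<Theta> \<bar>f x - Q x\<bar>)"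
proof -
  obtain B where B: "finite B" "real_fun.independent B" "real_fun.span B = S"
    using assms(2) by (auto simp: n_dim_space_def)
  have BC: "B \<subseteq> C_space a b" using B(3) real_fun.span_superset assms(3) by blast
  have contB: "continuous_on {a..b} e" if "e \<in> B" for e
    using that BC by (auto simp: C_space_def)
  have contf: "continuous_on {a..b} f" using assms(4) by (simp add: C_space_def)
  define L where "L = (\<lambda>t x. \<Sum>e\<in>B. t e * e x :: real)"
  define F where "F = (\<lambda>t. integral {a..b} (\<lambda>x. \<Theta> \<bar>f x - L t x\<bar>))"
  have S: "S = range L" using span_range_combination[OF B(1)] B(3) by (simp add: L_def)
  have contL: "continuous_on {a..b} (L t)" for t
    unfolding L_def by (intro continuous_intros contB)
  obtain \<delta> where \<delta>: "\<delta> > 0" "\<And>t. \<delta> * (\<Sum>e\<in>B. \<bar>t e\<bar>) \<le> integral {a..b} (\<lambda>x. \<bar>L t x\<bar>)"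
    using L1_norm_bounds_coefficients[OF assms(1) B(1,2) BC] unfolding L_def by blast
  define M where "M = \<alpha> * integral {a..b} (\<lambda>x. \<bar>f x\<bar>) + \<beta> * (b - a)"
  have lower: "\<alpha> * \<delta> * (\<Sum>e\<in>B. \<bar>t e\<bar>) - M \<le> F t" for t
  proof -
    have "\<alpha> * (\<delta> * (\<Sum>e\<in>B. \<bar>t e\<bar>)) - M \<le> \<alpha> * integral {a..b} (\<lambda>x. \<bar>L t x\<bar>) - M"
      using mult_left_mono[OF \<delta>(2), of \<alpha>] growth(1) by simp
    also have "\<dots> = integral {a..b} (\<lambda>x. \<alpha> * \<bar>L t x\<bar> - (\<alpha> * \<bar>f x\<bar> + \<beta>))"
      unfolding M_def using assms(1)
      by (subst integral_diff integral_add,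
          (auto intro!: integrable_continuous_real continuous_intros contL contf)[2])+
         (simp add: mult.commute)
    also have "\<dots> \<le> F t"
      unfolding F_def
    proof (rule integral_le)
      show "(\<lambda>x. \<alpha> * \<bar>L t x\<bar> - (\<alpha> * \<bar>f x\<bar> + \<beta>)) integrable_on {a..b}"
        by (intro integrable_continuous_real continuous_intros contL contf)
      show "(\<lambda>x. \<Theta> \<bar>f x - L t x\<bar>) integrable_on {a..b}"
        by (intro integrable_continuous_real continuous_on_compose2[OF cont] continuous_intros contL contf) auto
      fix x
      have "\<alpha> * \<bar>L t x\<bar> \<le> \<alpha> * (\<bar>f x - L t x\<bar> + \<bar>f x\<bar>)"
        using growth(1) by (intro mult_left_mono) auto
      then show "\<alpha> * \<bar>L t x\<bar> - (\<alpha> * \<bar>f x\<bar> + \<beta>) \<le> \<Theta> \<bar>f x - L t x\<bar>"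
        using growth(2)[of "\<bar>f x - L t x\<bar>"] by (simp add: distrib_left)
    qed
    finally show ?thesis by (simp add: mult.assoc)
  qed
  define R where "R = max 0 ((F (\<lambda>_. 0) + M) / (\<alpha> * \<delta>))"
  define K where "K = {t. \<forall>e. t e \<in> (if e \<in> B then {-R..R} else {0 :: real})}"
  have "compact K" unfolding K_def by (rule compact_coefficient_box)
  moreover have zeroK: "(\<lambda>_. 0) \<in> K" by (simp add: K_def R_def)
  moreover have "continuous_on K F"
    unfolding F_def L_def using continuous_on_combination_integral[OF cont contf contB] .
  ultimately obtain t0 where t0: "t0 \<in> K" "\<And>t. t \<in> K \<Longrightarrow> F t0 \<le> F t"
    using continuous_attains_inf[of K F] by blast
  have "F t0 \<le> F t" for t
  proof (cases "(\<Sum>e\<in>B. \<bar>t e\<bar>) \<le> R")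
    case True
    define t' where "t' = (\<lambda>e. if e \<in> B then t e else 0)"
    have "\<bar>t e\<bar> \<le> R" if "e \<in> B" for e
      using member_le_sum[of e B "\<lambda>e. \<bar>t e\<bar>"] B(1) that True by simp
    then have "t' \<in> K"
      by (auto simp: K_def t'_def abs_le_iff minus_le_iff)
    moreover have "F t' = F t" by (simp add: F_def L_def t'_def)
    ultimately show ?thesis using t0(2) by metis
  next
    case False
    then have "(F (\<lambda>_. 0) + M) / (\<alpha> * \<delta>) < (\<Sum>e\<in>B. \<bar>t e\<bar>)"
      by (simp add: R_def)
    then have "F (\<lambda>_. 0) + M < \<alpha> * \<delta> * (\<Sum>e\<in>B. \<bar>t e\<bar>)"
      using growth(1) \<delta>(1) by (simp add: pos_divide_less_eq mult.commute)
    then show ?thesis using lower[of t] t0(2)[OF zeroK] by simp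
  qed
  then show ?thesis
    using that[of "L t0"] by (auto simp: S F_def)
qed

text \<open>
  Beyond \<open>1\<close> a convex function lies above its chord over \<open>[0, 1]\<close>, extended as a line.  That line is
  lowered here by \<open>\<Phi> 1 - \<Phi> 0\<close>, which puts it below \<open>\<Phi> 0\<close> on all of \<open>[0, 1]\<close>.
\<close>

lemma convex_strict_mono_linear_growth:
  fixes \<Phi> :: "real \<Rightarrow> real"
  assumes "convex_on {0..} \<Phi>" and "strict_mono_on {0..} \<Phi>" and "x \<ge> 0"
  shows "(\<Phi> 1 - \<Phi> 0) * x - (\<Phi> 1 - 2 * \<Phi> 0) \<le> \<Phi> x"
proof (cases "x \<le> 1")
  case True
  have "\<Phi> 0 \<le> \<Phi> x" "\<Phi> 0 < \<Phi> 1"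
    using assms(3) strict_mono_on_leD[OF assms(2), of 0 x] strict_mono_onD[OF assms(2), of 0 1] by auto
  moreover from this have "(\<Phi> 1 - \<Phi> 0) * x \<le> \<Phi> 1 - \<Phi> 0"
    using True by (intro mult_left_le) auto
  ultimately show ?thesis by argo
next
  case False
  have "\<Phi> 1 \<le> (1 - 1 / x) * \<Phi> 0 + 1 / x * \<Phi> x"
    using convex_onD[OF assms(1), of "1/x" 0 x] False by simp
  then have "x * \<Phi> 1 \<le> x * ((1 - 1 / x) * \<Phi> 0 + 1 / x * \<Phi> x)"
    using False by (intro mult_left_mono) auto
  also have "\<dots> = (x - 1) * \<Phi> 0 + \<Phi> x" using False by (simp add: field_simps)
  finally have "(\<Phi> 1 - \<Phi> 0) * x + \<Phi> 0 \<le> \<Phi> x" by (simp add: algebra_simps)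
  moreover have "\<Phi> 0 < \<Phi> 1"
    using strict_mono_onD[OF assms(2), of 0 1] by auto
  ultimately show ?thesis by simp
qed

section \<open>Uniqueness\<close>

text \<open>
  An error that keeps one sign can be decreased everywhere at once by a small multiple of the
  positive element, so the error of a best approximant has a zero.
\<close>

lemma best_approximant_error_has_zero:
  fixes \<Phi> :: "real \<Rightarrow> real"
  assumes "a < b" and S: "real_fun.subspace S" "S \<subseteq> C_space a b"
    and h: "h \<in> S" "\<And>x. x \<in> {a..b} \<Longrightarrow> h x > 0"
    and f: "continuous_on {a..b} f"
    and \<Phi>: "continuous_on {0..} \<Phi>" "strict_mono_on {0..} \<Phi>"
    and P: "P \<in> S"
    and best: "\<And>Q. Q \<in> S \<Longrightarrow>
      integral {a..b} (\<lambda>x. \<Phi> \<bar>f x - P x\<bar>) \<le> integral {a..b} (\<lambda>x. \<Phi> \<bar>f x - Q x\<bar>)"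
  obtains x where "x \<in> {a..b}" and "f x = P x"
proof -
  have contS: "continuous_on {a..b} Q" if "Q \<in> S" for Q
    using that S(2) by (auto simp: C_space_def)
  have False if nz: "\<And>x. x \<in> {a..b} \<Longrightarrow> f x \<noteq> P x"
  proof -
    obtain s :: real where s: "\<bar>s\<bar> = 1" "\<And>x. x \<in> {a..b} \<Longrightarrow> f x - P x = s * \<bar>f x - P x\<bar>"
    proof (cases "\<forall>x\<in>{a..b}. f x - P x > 0")
      case True
      then have "f x - P x = 1 * \<bar>f x - P x\<bar>" if "x \<in> {a..b}" for x
        using that by force
      then show ?thesis using that[of 1] by simp
    next
      case False
      then obtain y where y: "y \<in> {a..b}" "f y - P y < 0" using nz by fastforce
      have "f x - P x < 0" if x: "x \<in> {a..b}" for x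
      proof (rule ccontr)
        assume "\<not> f x - P x < 0"
        moreover have "connected ((\<lambda>x. f x - P x) ` {a..b})"
          by (intro connected_continuous_image continuous_intros f contS P) auto
        ultimately have "0 \<in> (\<lambda>x. f x - P x) ` {a..b}"
          using x y connectedD_interval[of _ "f y - P y" "f x - P x" 0] by auto
        then show False using nz by force
      qed
      then show ?thesis using that[of "-1"] by fastforce
    qed
    have "continuous_on {a..b} (\<lambda>x. \<bar>f x - P x\<bar> / h x)"
      using h by (intro continuous_intros f contS P) force+
    then obtain y where y: "y \<in> {a..b}" "\<And>x. x \<in> {a..b} \<Longrightarrow> \<bar>f y - P y\<bar> / h y \<le> \<bar>f x - P x\<bar> / h x"
      using continuous_attains_inf[of "{a..b}" "\<lambda>x. \<bar>f x - P x\<bar> / h x"] assms(1) by auto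
    \<comment> \<open>The largest multiple of \<open>h\<close> that can be moved without the error changing its sign.\<close>
    define \<epsilon> where "\<epsilon> = \<bar>f y - P y\<bar> / h y"
    have \<epsilon>: "\<epsilon> > 0" using nz[OF y(1)] h(2)[OF y(1)] by (simp add: \<epsilon>_def)
    define Q where "Q = P + (\<lambda>x. (s * \<epsilon>) * h x)"
    have Q: "Q \<in> S"
      unfolding Q_def
      using real_fun.subspace_add[OF S(1) P real_fun.subspace_scale[OF S(1) h(1)]] .
    have err: "\<bar>f x - Q x\<bar> < \<bar>f x - P x\<bar>" if x: "x \<in> {a..b}" for x
    proof -
      have "\<epsilon> * h x \<le> \<bar>f x - P x\<bar>"
        using y(2)[OF x] h(2)[OF x] by (simp add: \<epsilon>_def[symmetric] pos_le_divide_eq)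
      moreover have "f x - Q x = s * (\<bar>f x - P x\<bar> - \<epsilon> * h x)"
        using s(2)[OF x] unfolding Q_def plus_fun_def right_diff_distrib by linarith
      ultimately have "\<bar>f x - Q x\<bar> = \<bar>f x - P x\<bar> - \<epsilon> * h x"
        using s(1) by (simp add: abs_mult)
      then show ?thesis using \<epsilon> h(2)[OF x] by simp
    qed
    have "integral {a..b} (\<lambda>x. \<Phi> \<bar>f x - Q x\<bar>) < integral {a..b} (\<lambda>x. \<Phi> \<bar>f x - P x\<bar>)"
    proof (rule integral_less_real)
      show "continuous_on {a..b} (\<lambda>x. \<Phi> \<bar>f x - Q x\<bar>)" "continuous_on {a..b} (\<lambda>x. \<Phi> \<bar>f x - P x\<bar>)"
        by (intro continuous_on_compose2[OF \<Phi>(1)] continuous_intros f contS P Q; auto)+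
      show "{a<..<b} \<noteq> {}" using assms(1) by simp
      show "\<Phi> \<bar>f x - Q x\<bar> < \<Phi> \<bar>f x - P x\<bar>" if "x \<in> {a<..<b}" for x
        using err[of x] that by (intro strict_mono_onD[OF \<Phi>(2)]) auto
    qed
    then show False using best[OF Q] by simp
  qed
  then show ?thesis using that by blast
qed

text \<open>
  The larger of two functions cannot pass a level without dragging the smaller one across it as
  well, unless the two meet exactly at that level.
\<close>

lemma gap_crosses_level:
  fixes u v :: "real \<Rightarrow> real"
  assumes "continuous_on {a..b} u" and "continuous_on {a..b} v"
    and "\<And>x. x \<in> {a..b} \<Longrightarrow> \<not> (min (u x) (v x) < c \<and> c < max (u x) (v x))"
    and "x0 \<in> {a..b}" and "max (u x0) (v x0) < c"
    and "x1 \<in> {a..b}" and "c < max (u x1) (v x1)"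
  obtains x where "x \<in> {a..b}" and "u x = c" and "v x = c"
proof -
  define A where "A = {x \<in> {a..b}. max (u x) (v x) \<le> c}"
  define B where "B = {x \<in> {a..b}. c \<le> min (u x) (v x)}"
  have "closed A" unfolding A_def
    by (intro continuous_on_closed_Collect_le continuous_on_max continuous_on_min continuous_on_const assms) auto
  moreover have "closed B" unfolding B_def
    by (intro continuous_on_closed_Collect_le continuous_on_max continuous_on_min continuous_on_const assms) auto
  moreover have "{a..b} \<subseteq> A \<union> B" using assms(3) by (force simp: A_def B_def)
  moreover have "A \<inter> {a..b} \<noteq> {}" "B \<inter> {a..b} \<noteq> {}"
    using assms(3)[OF assms(6)] assms(4-7) by (auto simp: A_def B_def)
  ultimately have "A \<inter> B \<inter> {a..b} \<noteq> {}"
    using connected_Icc[of a b] unfolding connected_closed by blast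
  then obtain x where "x \<in> A" "x \<in> B" "x \<in> {a..b}" by blast
  then show ?thesis using that[of x] by (auto simp: A_def B_def)
qed

text \<open>
  Equality in the integrated convexity inequality is equality at every point, by continuity.
  Since \<open>\<Phi>\<close> is strictly increasing, it forces the two errors to have the same sign as well.
\<close>

lemma midpoint_equality_pointwise:
  fixes \<Phi> g1 g2 :: "real \<Rightarrow> real"
  assumes "a < b" and \<Phi>: "continuous_on {0..} \<Phi>" "convex_on {0..} \<Phi>" "strict_mono_on {0..} \<Phi>"
    and g: "continuous_on {a..b} g1" "continuous_on {a..b} g2"
    and le: "(integral {a..b} (\<lambda>x. \<Phi> \<bar>g1 x\<bar>) + integral {a..b} (\<lambda>x. \<Phi> \<bar>g2 x\<bar>)) / 2
      \<le> integral {a..b} (\<lambda>x. \<Phi> \<bar>(g1 x + g2 x) / 2\<bar>)"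
    and x: "x \<in> {a..b}"
  shows "\<bar>g1 x + g2 x\<bar> = \<bar>g1 x\<bar> + \<bar>g2 x\<bar>"
    and "\<Phi> ((\<bar>g1 x\<bar> + \<bar>g2 x\<bar>) / 2) = (\<Phi> \<bar>g1 x\<bar> + \<Phi> \<bar>g2 x\<bar>) / 2"
proof -
  define d where "d = (\<lambda>x. (\<Phi> \<bar>g1 x\<bar> + \<Phi> \<bar>g2 x\<bar>) / 2 - \<Phi> \<bar>(g1 x + g2 x) / 2\<bar>)"
  have tri: "\<bar>(g1 x + g2 x) / 2\<bar> \<le> (\<bar>g1 x\<bar> + \<bar>g2 x\<bar>) / 2" for x
    using abs_triangle_ineq[of "g1 x" "g2 x"] by simp
  have mono: "\<Phi> \<bar>(g1 x + g2 x) / 2\<bar> \<le> \<Phi> ((\<bar>g1 x\<bar> + \<bar>g2 x\<bar>) / 2)" for x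
    using tri by (intro strict_mono_on_leD[OF \<Phi>(3)]) auto
  have cvx: "\<Phi> ((\<bar>g1 x\<bar> + \<bar>g2 x\<bar>) / 2) \<le> (\<Phi> \<bar>g1 x\<bar> + \<Phi> \<bar>g2 x\<bar>) / 2" for x
    using convex_onD[OF \<Phi>(2), of "1/2" "\<bar>g1 x\<bar>" "\<bar>g2 x\<bar>"] by (simp add: field_simps)
  have c: "continuous_on {a..b} (\<lambda>x. \<Phi> \<bar>g1 x\<bar>)" "continuous_on {a..b} (\<lambda>x. \<Phi> \<bar>g2 x\<bar>)"
    "continuous_on {a..b} (\<lambda>x. \<Phi> \<bar>(g1 x + g2 x) / 2\<bar>)"
    by (intro continuous_on_compose2[OF \<Phi>(1)] continuous_intros g; auto)+
  then have cd: "continuous_on {a..b} d"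
    unfolding d_def by (intro continuous_intros) auto
  have d0: "d x \<ge> 0" for x using mono[of x] cvx[of x] by (simp add: d_def)
  note ints = integrable_continuous_real[OF c(1)] integrable_continuous_real[OF c(2)]
    integrable_continuous_real[OF c(3)]
  have "integral {a..b} d = (integral {a..b} (\<lambda>x. \<Phi> \<bar>g1 x\<bar>) + integral {a..b} (\<lambda>x. \<Phi> \<bar>g2 x\<bar>)) / 2
      - integral {a..b} (\<lambda>x. \<Phi> \<bar>(g1 x + g2 x) / 2\<bar>)"
    unfolding d_def using ints
    by (subst integral_diff) (auto simp: integral_add intro!: integrable_add integrable_on_divide)
  then have "integral {a..b} d \<le> 0" using le by simp
  moreover have "integral {a..b} d \<ge> 0"
    using d0 by (intro integral_nonneg integrable_continuous_real cd)
  ultimately have "d x = 0"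
    using integral_eq_0_iff[OF cd assms(1) d0] x by auto
  then have eqs: "\<Phi> \<bar>(g1 x + g2 x) / 2\<bar> = \<Phi> ((\<bar>g1 x\<bar> + \<bar>g2 x\<bar>) / 2)"
    "\<Phi> ((\<bar>g1 x\<bar> + \<bar>g2 x\<bar>) / 2) = (\<Phi> \<bar>g1 x\<bar> + \<Phi> \<bar>g2 x\<bar>) / 2"
    using mono[of x] cvx[of x] by (simp_all add: d_def)
  have "\<not> \<bar>(g1 x + g2 x) / 2\<bar> < (\<bar>g1 x\<bar> + \<bar>g2 x\<bar>) / 2"
    using strict_mono_onD[OF \<Phi>(3), of "\<bar>(g1 x + g2 x) / 2\<bar>" "(\<bar>g1 x\<bar> + \<bar>g2 x\<bar>) / 2"] eqs(1) by auto
  then show "\<bar>g1 x + g2 x\<bar> = \<bar>g1 x\<bar> + \<bar>g2 x\<bar>"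
    using abs_triangle_ineq[of "g1 x" "g2 x"] by simp
  show "\<Phi> ((\<bar>g1 x\<bar> + \<bar>g2 x\<bar>) / 2) = (\<Phi> \<bar>g1 x\<bar> + \<Phi> \<bar>g2 x\<bar>) / 2" by (rule eqs(2))
qed

text \<open>
  Near a zero of the midpoint error both \<open>u\<close> and \<open>v\<close> are small, and on the way up they must
  coincide at each of the infinitely many jump points met, which is more often than the finitely
  many zeros of \<open>P1 - P2\<close> permit.
\<close>

lemma best_approximant_unique:
  fixes \<Phi> \<phi> :: "real \<Rightarrow> real" and c :: "nat \<Rightarrow> real"
  assumes "a < b" and convex: "convex_on {0..} \<Phi>" and \<phi>: "\<phi> \<in> Im_class" "has_density \<Phi> \<phi>"
    and c: "\<And>k. c k > 0" "\<And>k. c (Suc k) < c k" "c \<longlonglongrightarrow> 0"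
    and jump: "\<And>k. \<not> continuous (at (c k) within {0..}) \<phi>"
    and S: "real_fun.subspace S" "S \<subseteq> C_space a b"
    and h: "h \<in> S" "\<And>x. x \<in> {a..b} \<Longrightarrow> h x > 0"
    and fin: "\<And>P. P \<in> S \<Longrightarrow> P \<noteq> 0 \<Longrightarrow> finite {x \<in> {a..b}. P x = 0}"
    and f: "continuous_on {a..b} f"
    and P1: "P1 \<in> S" "\<And>Q. Q \<in> S \<Longrightarrow>
      integral {a..b} (\<lambda>x. \<Phi> \<bar>f x - P1 x\<bar>) \<le> integral {a..b} (\<lambda>x. \<Phi> \<bar>f x - Q x\<bar>)"
    and P2: "P2 \<in> S" "\<And>Q. Q \<in> S \<Longrightarrow>
      integral {a..b} (\<lambda>x. \<Phi> \<bar>f x - P2 x\<bar>) \<le> integral {a..b} (\<lambda>x. \<Phi> \<bar>f x - Q x\<bar>)"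
  shows "P1 = P2"
proof (rule ccontr)
  assume neq: "P1 \<noteq> P2"
  have mono: "mono_on {0..} \<phi>" using \<phi>(1) by (simp add: Im_class_def)
  have cont: "continuous_on {0..} \<Phi>" by (rule density_continuous[OF mono \<phi>(2)])
  have strict: "strict_mono_on {0..} \<Phi>" by (rule density_strict_mono[OF \<phi>])
  have contS: "continuous_on {a..b} Q" if "Q \<in> S" for Q
    using that S(2) by (auto simp: C_space_def)
  define u where "u = (\<lambda>x. \<bar>f x - P1 x\<bar>)"
  define v where "v = (\<lambda>x. \<bar>f x - P2 x\<bar>)"
  have contuv: "continuous_on {a..b} u" "continuous_on {a..b} v"
    unfolding u_def v_def by (intro continuous_intros f contS P1 P2)+
  define P where "P = (\<lambda>x. (1/2) * (P1 + P2) x)"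
  have P: "P \<in> S"
    unfolding P_def using real_fun.subspace_scale[OF S(1) real_fun.subspace_add[OF S(1) P1(1) P2(1)]] .
  have mid: "(f x - P1 x + (f x - P2 x)) / 2 = f x - P x" for x
    by (simp add: P_def field_simps)
  have le: "(integral {a..b} (\<lambda>x. \<Phi> \<bar>f x - P1 x\<bar>) + integral {a..b} (\<lambda>x. \<Phi> \<bar>f x - P2 x\<bar>)) / 2
      \<le> integral {a..b} (\<lambda>x. \<Phi> \<bar>(f x - P1 x + (f x - P2 x)) / 2\<bar>)"
    unfolding mid using P1(2)[OF P] P2(2)[OF P] by simp
  have same: "\<bar>f x - P1 x + (f x - P2 x)\<bar> = u x + v x"
    and affine: "\<Phi> ((u x + v x) / 2) = (\<Phi> (u x) + \<Phi> (v x)) / 2" if "x \<in> {a..b}" for x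
    using midpoint_equality_pointwise[OF assms(1) cont convex strict _ _ le that] f contS P1(1) P2(1)
    by (auto simp: u_def v_def continuous_on_diff)
  have nojump: "\<not> (min (u x) (v x) < c k \<and> c k < max (u x) (v x))" if "x \<in> {a..b}" for x k
    using no_jump_in_affine_gap[OF mono \<phi>(2) _ _ jump[of k], of "min (u x) (v x)" "max (u x) (v x)"]
      affine[OF that] by (auto simp: u_def v_def min_def max_def add.commute split: if_splits)
  have integrable: "(\<lambda>x. \<Phi> \<bar>f x - Q x\<bar>) integrable_on {a..b}" if "Q \<in> S" for Q
  proof (rule integrable_continuous_real)
    have "continuous_on {a..b} (\<lambda>x. \<bar>f x - Q x\<bar>)"
      by (intro continuous_on_rabs continuous_on_diff f contS[OF that])
    then show "continuous_on {a..b} (\<lambda>x. \<Phi> \<bar>f x - Q x\<bar>)"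
      by (rule continuous_on_compose2[OF cont]) auto
  qed
  define Z where "Z = {x \<in> {a..b}. (P1 - P2) x = 0}"
  have finZ: "finite Z"
    unfolding Z_def
    by (rule fin[OF real_fun.subspace_diff[OF S(1) P1(1) P2(1)]]) (use neq in simp)
  have meet: "x \<in> Z" if "x \<in> {a..b}" "u x = v x" for x
  proof -
    have "f x - P1 x = f x - P2 x"
      using same[OF that(1)] that(2) unfolding u_def v_def by linarith
    then show ?thesis using that(1) by (simp add: Z_def)
  qed
  \<comment> \<open>The midpoint is again a best approximant, so its error has a zero \<open>x0\<close>; since the modulus of
    that error is \<open>(u + v) / 2\<close>, both \<open>u\<close> and \<open>v\<close> vanish at \<open>x0\<close>.\<close>
  have "integral {a..b} (\<lambda>x. \<Phi> \<bar>f x - P x\<bar>) \<le> integral {a..b} (\<lambda>x. \<Phi> \<bar>f x - Q x\<bar>)" if "Q \<in> S" for Q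
  proof -
    have "integral {a..b} (\<lambda>x. \<Phi> \<bar>f x - P x\<bar>)
        = integral {a..b} (\<lambda>x. (\<Phi> \<bar>f x - P1 x\<bar> + \<Phi> \<bar>f x - P2 x\<bar>) / 2)"
    proof (rule integral_cong)
      fix x assume "x \<in> {a..b}"
      then have err: "\<bar>f x - P x\<bar> = (u x + v x) / 2"
        unfolding mid[symmetric] using same[of x] by simp
      then show "\<Phi> \<bar>f x - P x\<bar> = (\<Phi> \<bar>f x - P1 x\<bar> + \<Phi> \<bar>f x - P2 x\<bar>) / 2"
        unfolding err affine[OF \<open>x \<in> {a..b}\<close>] by (simp add: u_def v_def)
    qed
    also have "\<dots> = (integral {a..b} (\<lambda>x. \<Phi> \<bar>f x - P1 x\<bar>) + integral {a..b} (\<lambda>x. \<Phi> \<bar>f x - P2 x\<bar>)) / 2"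
      using integral_add[OF integrable[OF P1(1)] integrable[OF P2(1)]] by simp
    also have "\<dots> \<le> integral {a..b} (\<lambda>x. \<Phi> \<bar>f x - Q x\<bar>)"
      using P1(2)[OF that] P2(2)[OF that] by simp
    finally show ?thesis .
  qed
  then obtain x0 where x0: "x0 \<in> {a..b}" "f x0 = P x0"
    using best_approximant_error_has_zero[OF assms(1) S h f cont strict P] by blast
  then have zero: "max (u x0) (v x0) = 0"
  proof -
    have "f x0 - P1 x0 + (f x0 - P2 x0) = 0" using mid[of x0] x0(2) by argo
    then have "u x0 + v x0 = 0" using same[OF x0(1)] by (metis abs_zero)
    then show ?thesis by (auto simp: u_def v_def)
  qed
  have "infinite ({a..b} - Z)" using finZ assms(1) by (simp add: infinite_Icc)
  then obtain x1 where x1: "x1 \<in> {a..b}" "x1 \<notin> Z"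
    by (metis Diff_iff finite.emptyI ex_in_conv)
  then have pos: "max (u x1) (v x1) > 0"
    using meet[of x1] by (force simp: u_def v_def)
  \<comment> \<open>A jump point below the maximum at \<open>x1\<close> that avoids the finitely many values of \<open>u\<close> on \<open>Z\<close>.\<close>
  have "inj c"
  proof -
    have "strict_mono (\<lambda>k. - c k)" using c(2) by (simp add: strict_mono_Suc_iff)
    then have "inj (\<lambda>k. - c k)" by (rule strict_mono_imp_inj_on)
    then show ?thesis by (simp add: inj_def)
  qed
  then have "finite (c -` u ` Z)" using finZ by (intro finite_vimageI) auto
  moreover obtain N where N: "\<And>k. k \<ge> N \<Longrightarrow> c k < max (u x1) (v x1)"
    using order_tendstoD(2)[OF c(3) pos] by (auto simp: eventually_sequentially)
  ultimately have "{N..} - c -` u ` Z \<noteq> {}"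
    by (metis Diff_infinite_finite finite.emptyI infinite_Ici)
  then have "\<exists>k. c k < max (u x1) (v x1) \<and> c k \<notin> u ` Z"
    using N by auto
  then obtain k where k: "c k < max (u x1) (v x1)" "c k \<notin> u ` Z" by blast
  obtain x where "x \<in> {a..b}" "u x = c k" "v x = c k"
    using gap_crosses_level[OF contuv nojump[of _ k] x0(1) _ x1(1) k(1)] zero c(1) by auto
  then show False using meet[of x] k(2) by force
qed

lemma mu_iff_minimal:
  assumes "P0 \<in> S" and "\<And>Q. Q \<in> S \<Longrightarrow>
    integral {a..b} (\<lambda>x. \<Phi> \<bar>f x - P0 x\<bar>) \<le> integral {a..b} (\<lambda>x. \<Phi> \<bar>f x - Q x\<bar>)"
  shows "P \<in> mu \<Phi> a b f S \<longleftrightarrow> P \<in> S \<and> (\<forall>Q\<in>S.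
    integral {a..b} (\<lambda>x. \<Phi> \<bar>f x - P x\<bar>) \<le> integral {a..b} (\<lambda>x. \<Phi> \<bar>f x - Q x\<bar>))"
proof -
  define E where "E = (\<lambda>Q. integral {a..b} (\<lambda>x. \<Phi> \<bar>f x - Q x\<bar>))"
  have min: "E P0 \<le> E Q" if "Q \<in> S" for Q using assms(2)[OF that] by (simp add: E_def)
  have "Inf (E ` S) = E P0"
    using assms(1) min by (intro cInf_eq_minimum) auto
  then have "P \<in> mu \<Phi> a b f S \<longleftrightarrow> P \<in> S \<and> E P = E P0"
    by (simp add: mu_def E_def)
  also have "\<dots> \<longleftrightarrow> P \<in> S \<and> (\<forall>Q\<in>S. E P \<le> E Q)"
    using assms(1) min by (metis order_antisym)
  finally show ?thesis unfolding E_def .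
qed

theorem theorem3p7:
  fixes a b :: real and n :: nat and S :: "(real \<Rightarrow> real) set"
    and \<Phi> \<phi> :: "real \<Rightarrow> real" and c :: "nat \<Rightarrow> real"
  assumes "a < b"
    and "\<Phi> \<in> Psi_class" and "Delta2 \<Phi>"
    and "\<phi> \<in> Im_class" and "has_density \<Phi> \<phi>"
    and "\<And>k. c k > 0" and "\<And>k. c (Suc k) < c k" and "c \<longlonglongrightarrow> 0"
    and "\<And>k. \<not> continuous (at (c k) within {0..}) \<phi>"
    and "one_space a b n S"
    and "\<And>P. P \<in> S \<Longrightarrow> P \<noteq> 0 \<Longrightarrow> finite {x \<in> {a..b}. P x = 0}"
  shows "\<forall>f \<in> C_space a b. is_singleton (mu \<Phi> a b f S)"
proof
  fix f assume f: "f \<in> C_space a b"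
  then have contf: "continuous_on {a..b} f" by (simp add: C_space_def)
  have convex: "convex_on {0..} \<Phi>" using assms(2) by (simp add: Psi_class_def)
  have cont: "continuous_on {0..} \<Phi>"
    using assms(4,5) by (intro density_continuous[of \<phi>]) (auto simp: Im_class_def)
  have strict: "strict_mono_on {0..} \<Phi>"
    by (rule density_strict_mono[OF assms(4,5)])
  obtain h where S: "n_dim_space n S" "S \<subseteq> C_space a b"
    and h: "h \<in> S" "\<And>x. x \<in> {a..b} \<Longrightarrow> h x > 0"
    using assms(10) by (auto simp: one_space_def)
  have sub: "real_fun.subspace S" using S(1) by (simp add: n_dim_space_def)
  have slope: "\<Phi> 1 - \<Phi> 0 > 0" using strict_mono_onD[OF strict, of 0 1] by simp
  obtain P where P: "P \<in> S" "\<And>Q. Q \<in> S \<Longrightarrow>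
      integral {a..b} (\<lambda>x. \<Phi> \<bar>f x - P x\<bar>) \<le> integral {a..b} (\<lambda>x. \<Phi> \<bar>f x - Q x\<bar>)"
    using best_approximant_exists[OF assms(1) S f cont slope
        convex_strict_mono_linear_growth[OF convex strict]] by blast
  note mu = mu_iff_minimal[OF P]
  have "mu \<Phi> a b f S = {P}"
  proof (intro equalityI subsetI)
    fix Q assume "Q \<in> mu \<Phi> a b f S"
    then have "Q \<in> S" "\<And>Q'. Q' \<in> S \<Longrightarrow>
        integral {a..b} (\<lambda>x. \<Phi> \<bar>f x - Q x\<bar>) \<le> integral {a..b} (\<lambda>x. \<Phi> \<bar>f x - Q' x\<bar>)"
      using mu P(1) by blast+
    then have "Q = P"
      using best_approximant_unique[OF assms(1) convex assms(4-9) sub S(2) h assms(11) contf _ _ P] by blast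
    then show "Q \<in> {P}" by simp
  qed (use mu P in blast)
  then show "is_singleton (mu \<Phi> a b f S)" by simp
qed

end
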